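(* Let $n$ be any non-negative integer and let $\beta$ be a positive real number with $\beta\ge 2e^n$. If a function $f\in\mathcal{H}$ satisfies the subordination $$1+\beta\left(\frac{zf'(z)}{f(z)}\right)^{-n}\left(1-\frac{zf'(z)}{f(z)}+\frac{zf''(z)}{f'(z)}\right)\prec\frac{2+z}{2-z},$$ then $f\in\mathcal{S}^*_e$.
   Context: $\mathbb{D}=\{z\in\mathbb{C}:|z|<1\}$. $\mathcal{H}$ is the class of analytic functions $f$ on $\mathbb{D}$ with $f(0)=0$ and $f'(0)=1$. For functions $F,G$ analytic in $\mathbb{D}$, $F\prec G$ ($F$ is subordinate to $G$) means that there is an analytic function $w$ on $\mathbb{D}$ with $w(0)=0$, $|w(z)|<1$ and $F(z)=G(w(z))$ for all $z\in\mathbb{D}$. $\mathcal{S}^*_e$ is the class of $f\in\mathcal{H}$ with $zf'(z)/f(z)\prec e^z$. *)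

theory Defs
  imports "HOL-Complex_Analysis.Complex_Analysis"
begin

abbreviation unit_disc :: "complex set" where
  "unit_disc \<equiv> ball 0 1"

definition class_H :: "(complex \<Rightarrow> complex) set" where
  "class_H = {f. f holomorphic_on unit_disc \<and> f 0 = 0 \<and> deriv f 0 = 1}"

definition subordinate :: "(complex \<Rightarrow> complex) \<Rightarrow> (complex \<Rightarrow> complex) \<Rightarrow> bool" where
  "subordinate F G \<longleftrightarrow>
     F holomorphic_on unit_disc \<and> G holomorphic_on unit_disc \<and>
     (\<exists>w. w holomorphic_on unit_disc \<and> w 0 = 0 \<and>
          (\<forall>z\<in>unit_disc. norm (w z) < 1 \<and> F z = G (w z)))"

definition star_quot :: "(complex \<Rightarrow> complex) \<Rightarrow> complex \<Rightarrow> complex" where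
  "star_quot f z = z * deriv f z / f z"

definition convex_quot :: "(complex \<Rightarrow> complex) \<Rightarrow> complex \<Rightarrow> complex" where
  "convex_quot f z = z * deriv (deriv f) z / deriv f z"

text \<open>
  The two quotients are meromorphic; since \<open>x / 0 = 0\<close> in HOL, they carry
  arbitrary values at the (isolated) zeros of their denominators, in particular
  \<open>star_quot f 0 = 0\<close> instead of the intended value \<open>1\<close>. Whenever an expression built from
  them is compared by subordination, it is therefore passed through \<^const>\<open>remove_sings\<close>,
  which fills in removable singularities by limits. A genuine pole in the disc is
  not removed, and the holomorphy clause of \<open>subordinate\<close> then fails.
\<close>

definition class_S_star_e :: "(complex \<Rightarrow> complex) set" where
  "class_S_star_e = {f \<in> class_H. subordinate (remove_sings (star_quot f)) exp}"

end

(*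
  With p = z f'/f, the hypothesis reads z p'/p^(n+1) = z H(z), where |H| <= 2/beta <= e^(-n)
  by the Schwarz lemma. Let G be the primitive of H with G(0) = 0. Then p^(-n) = 1 - n G, so
  L = -Ln(1 - n G)/n (and L = G if n = 0) should be log p. Since |n G| < n e^(-n) <= 1 - e^(-n),
  L is defined on the whole disc and |L| < 1. Now p = exp L only has to be checked near 0:
  z f' = (exp L) f then holds everywhere by the identity theorem, which spares an analysis
  of the zeros of f and f'.
*)
theory Submission
  imports Defs
begin

section \<open>Logarithm estimate and explicit solution of the differential equation\<close>

text \<open>The power series of -Ln(1 - x) has nonnegative coefficients, so it is dominated termwise
  by the same series at the real point \<open>norm x\<close>.\<close>

lemma norm_Ln_one_minus_le:
  fixes x :: complex
  assumes "norm x < 1"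
  shows "norm (Ln (1 - x)) \<le> - ln (1 - norm x)"
proof -
  \<comment> \<open>The sum starts at k = 0, where the term is 0 because division by zero yields
    0.\<close>
  have x: "(\<lambda>k. - (x ^ k) / of_nat k) sums Ln (1 - x)"
    using Ln_series'[of "- x"] assms by simp
  have "(\<lambda>k. - (of_real (norm x) ^ k) / of_nat k :: complex) sums Ln (1 - of_real (norm x))"
    using Ln_series'[of "- of_real (norm x)"] assms by simp
  moreover have "Ln (1 - of_real (norm x)) = of_real (ln (1 - norm x))"
    using Ln_of_real[of "1 - norm x"] assms by simp
  ultimately have "(\<lambda>k. of_real (- (norm x ^ k) / real k) :: complex) sums of_real (ln (1 - norm x))"
    by simp
  then have "(\<lambda>k. - (norm x ^ k) / real k) sums ln (1 - norm x)"
    by (simp only: sums_of_real_iff)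
  then have "(\<lambda>k. norm x ^ k / real k) sums (- ln (1 - norm x))"
    by (auto dest: sums_minus)
  with x show ?thesis
    by (rule norm_sums_le) (simp add: norm_divide norm_power)
qed

text \<open>For p = exp L the equation p'/p^(n+1) = H becomes L' = H exp(n L). It separates as
  (exp(-n L))' = -n H and can be integrated explicitly.\<close>

lemma exists_small_solution:
  fixes H :: "complex \<Rightarrow> complex" and n :: nat
  assumes hol: "H holomorphic_on unit_disc"
    and bound: "\<And>z. z \<in> unit_disc \<Longrightarrow> norm (H z) \<le> exp (- real n)"
  obtains L where "L 0 = 0" and "\<And>z. z \<in> unit_disc \<Longrightarrow> norm (L z) < 1"
    and "\<And>z. z \<in> unit_disc \<Longrightarrow> (L has_field_derivative H z * exp (of_nat n * L z)) (at z)"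
proof -
  obtain G0 where G0: "\<And>z. z \<in> unit_disc \<Longrightarrow> (G0 has_field_derivative H z) (at z within unit_disc)"
    using holomorphic_convex_primitive'[OF _ _ hol] by auto
  define G where "G z = G0 z - G0 0" for z
  have G_deriv: "(G has_field_derivative H z) (at z)" if "z \<in> unit_disc" for z
    using G0[OF that] that unfolding G_def
    by (auto intro!: derivative_eq_intros simp: at_within_open[OF that open_ball])
  have G_bound: "norm (G z) < exp (- real n)" if z: "z \<in> unit_disc" for z
  proof -
    have "norm (G0 z - G0 0) \<le> exp (- real n) * norm (z - 0)"
      by (rule field_differentiable_bound[OF convex_ball G0]) (use z bound in auto)
    also have "\<dots> < exp (- real n) * 1"
      using z by (intro mult_strict_left_mono) auto
    finally show ?thesis by (simp add: G_def)
  qed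
  show thesis
  \<comment> \<open>For n = 0 the logarithmic formula would divide by zero. The equation is then L'
    = H, solved by \<open>G\<close> itself, whose norm is below exp 0 = 1.\<close>
  proof (cases "n = 0")
    case True
    then show thesis
      using G_deriv G_bound by (intro that[of G]) (auto simp: G_def)
  next
    case False
    define L where "L z = - Ln (1 - of_nat n * G z) / of_nat n" for z
    have nG: "norm (of_nat n * G z) < 1 - exp (- real n)" if "z \<in> unit_disc" for z
    proof -
      have "norm (of_nat n * G z) < real n * exp (- real n)"
        using G_bound[OF that] False by (simp add: norm_mult)
      \<comment> \<open>This is n \<le> e^n - 1 multiplied by e^(-n). The resulting bound says that
        1 - |n G| exceeds e^(-n), whence |Ln(1 - n G)| < n and |L| < 1.\<close>
      also have "\<dots> \<le> (exp (real n) - 1) * exp (- real n)"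
        by (rule mult_right_mono) (use exp_ge_add_one_self[of "real n"] in linarith, simp)
      also have "\<dots> = 1 - exp (- real n)"
        by (simp add: left_diff_distrib flip: exp_add)
      finally show ?thesis .
    qed
    have nG1: "norm (of_nat n * G z) < 1" if "z \<in> unit_disc" for z
      using nG[OF that] exp_gt_zero[of "- real n"] by linarith
    \<comment> \<open>The right half-plane avoids both 0 and the branch cut of
      \<open>Ln\<close>.\<close>
    have Re_pos: "Re (1 - of_nat n * G z) > 0" if "z \<in> unit_disc" for z
      using nG1[OF that] complex_Re_le_cmod[of "of_nat n * G z"] by simp
    have exp_L: "exp (of_nat n * L z) = inverse (1 - of_nat n * G z)" if "z \<in> unit_disc" for z
    proof -
      have "1 - of_nat n * G z \<noteq> 0"
        using Re_pos[OF that] by force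
      then show ?thesis
        using False by (simp add: L_def exp_minus)
    qed
    show thesis
    proof (rule that[of L])
      show "L 0 = 0"
        by (simp add: L_def G_def)
    next
      fix z :: complex
      assume z: "z \<in> unit_disc"
      have "norm (Ln (1 - of_nat n * G z)) \<le> - ln (1 - norm (of_nat n * G z))"
        by (rule norm_Ln_one_minus_le[OF nG1[OF z]])
      also have "\<dots> < real n"
      proof -
        have "ln (exp (- real n)) < ln (1 - norm (of_nat n * G z))"
          using nG[OF z] nG1[OF z] by (subst ln_less_cancel_iff) auto
        then show ?thesis by simp
      qed
      finally show "norm (L z) < 1"
        using False by (simp add: L_def norm_divide)
      have "1 - of_nat n * G z \<notin> \<real>\<^sub>\<le>\<^sub>0"
        using Re_pos[OF z] by (auto simp: complex_nonpos_Reals_iff)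
      then have "((\<lambda>z. Ln (1 - of_nat n * G z)) has_field_derivative
          inverse (1 - of_nat n * G z) * - (of_nat n * H z)) (at z)"
        by (auto intro!: derivative_eq_intros G_deriv[OF z] simp: field_simps)
      from DERIV_cdivide[OF DERIV_minus[OF this], of "of_nat n"]
      show "(L has_field_derivative H z * exp (of_nat n * L z)) (at z)"
        using False unfolding exp_L[OF z] unfolding L_def by (simp add: mult.commute)
    qed
  qed
qed

section \<open>Uniqueness for the differential equation\<close>

text \<open>Up to the factor -n the two sides are the derivatives of p^(-n) and q^(-n), so these
  powers agree. Cancelling p^n = q^n leaves p'/p = q'/q, so p/q is constant; this second step fixes
  the choice of the n-th root and carries the whole argument when n = 0. The equation is assumed
  only off \<open>a\<close> because the quotients of f have default values at the origin.\<close>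

lemma power_ode_unique:
  fixes p q :: "complex \<Rightarrow> complex"
  assumes "open S" "connected S" "a \<in> S"
    and p: "p holomorphic_on S" "\<And>z. z \<in> S \<Longrightarrow> p z \<noteq> 0"
    and q: "q holomorphic_on S" "\<And>z. z \<in> S \<Longrightarrow> q z \<noteq> 0"
    and "p a = q a"
    and ode: "\<And>z. z \<in> S - {a} \<Longrightarrow> deriv p z / p z ^ Suc n = deriv q z / q z ^ Suc n"
    and "z \<in> S"
  shows "p z = q z"
proof -
  note deriv = p(1)[THEN holomorphic_derivI, OF \<open>open S\<close>] q(1)[THEN holomorphic_derivI, OF \<open>open S\<close>]
  note cont = p(1)[THEN holomorphic_on_imp_continuous_on] q(1)[THEN holomorphic_on_imp_continuous_on]
  have pow: "inverse (p z) ^ n = inverse (q z) ^ n" if "z \<in> S" for z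
  proof -
    have d: "((\<lambda>z. inverse (r z) ^ n) has_field_derivative - of_nat n * (deriv r z / r z ^ Suc n)) (at z)"
      if "(r has_field_derivative deriv r z) (at z)" "r z \<noteq> 0" for r :: "complex \<Rightarrow> complex" and z
      \<comment> \<open>The case split handles the exponent n - 1 of the power rule, which is
        truncated at n = 0.\<close>
      using DERIV_power[OF DERIV_inverse'[OF that], of n]
      by (cases n) (simp_all add: divide_inverse power_inverse algebra_simps)
    obtain c where c: "\<And>z. z \<in> S \<Longrightarrow> inverse (p z) ^ n - inverse (q z) ^ n = c"
    \<comment> \<open>At finitely many exceptional points, here \<open>a\<close>, continuity alone
      suffices.\<close>
    proof (rule DERIV_zero_connected_constant[OF \<open>connected S\<close> \<open>open S\<close>, of "{a}"])
      show "continuous_on S (\<lambda>z. inverse (p z) ^ n - inverse (q z) ^ n)"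
        using p(2) q(2) by (intro continuous_intros cont) auto
      show "\<forall>z\<in>S - {a}. ((\<lambda>z. inverse (p z) ^ n - inverse (q z) ^ n) has_field_derivative 0) (at z)"
      proof
        fix z assume z: "z \<in> S - {a}"
        show "((\<lambda>z. inverse (p z) ^ n - inverse (q z) ^ n) has_field_derivative 0) (at z)"
          using DERIV_diff[OF d[of p z] d[of q z]] deriv[of z] p(2)[of z] q(2)[of z] z
          unfolding ode[OF z] by simp
      qed
    qed auto
    with \<open>p a = q a\<close> \<open>a \<in> S\<close> have "c = 0" by force
    with c[OF that] show ?thesis by simp
  qed
  obtain c where c: "\<And>z. z \<in> S \<Longrightarrow> p z / q z = c"
  proof (rule DERIV_zero_connected_constant[OF \<open>connected S\<close> \<open>open S\<close>, of "{a}"])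
    show "continuous_on S (\<lambda>z. p z / q z)"
      using p(2) q(2) by (intro continuous_intros cont) auto
    show "\<forall>z\<in>S - {a}. ((\<lambda>z. p z / q z) has_field_derivative 0) (at z)"
    proof
      fix z assume z: "z \<in> S - {a}"
      have nz: "p z \<noteq> 0" "q z \<noteq> 0" using p(2) q(2) z by auto
      have "p z ^ n = q z ^ n"
        using pow[of z] z by (simp add: power_inverse)
      then have "deriv p z * q z = p z * deriv q z"
        using ode[OF z] nz by (simp add: field_simps)
      then show "((\<lambda>z. p z / q z) has_field_derivative 0) (at z)"
        using DERIV_divide[OF deriv(1)[of z] deriv(2)[of z] nz(2)] z by simp
    qed
  qed auto
  have "c = 1"
    using c[OF \<open>a \<in> S\<close>] \<open>p a = q a\<close> q(2)[OF \<open>a \<in> S\<close>] by simp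
  with c[OF \<open>z \<in> S\<close>] q(2)[OF \<open>z \<in> S\<close>] show ?thesis by simp
qed

section \<open>Analytic form of the hypothesis near the origin\<close>

text \<open>Here (F - 1)/2 = w/(2 - w), and |2 - w| \<ge> 2 - |w| > 1 > |w|. So this function maps
  the disc into itself and fixes 0, and the Schwarz lemma bounds its quotient by z.\<close>

lemma subordinate_half_plane_kernel:
  assumes sub: "subordinate F (\<lambda>z. (2 + z) / (2 - z))"
  obtains H where "H holomorphic_on unit_disc"
    and "\<And>z. z \<in> unit_disc \<Longrightarrow> F z = 1 + z * H z"
    and "\<And>z. z \<in> unit_disc \<Longrightarrow> norm (H z) \<le> 2"
proof -
  from sub obtain w where holF: "F holomorphic_on unit_disc" and w0: "w 0 = 0"
    and w: "\<And>z. z \<in> unit_disc \<Longrightarrow> norm (w z) < 1"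
    and Fw: "\<And>z. z \<in> unit_disc \<Longrightarrow> F z = (2 + w z) / (2 - w z)"
    unfolding subordinate_def by auto
  define V where "V z = (F z - 1) / 2" for z
  have holV: "V holomorphic_on unit_disc"
    unfolding V_def by (intro holomorphic_intros holF) auto
  have V0: "V 0 = 0"
    using Fw[of 0] w0 by (simp add: V_def)
  have V1: "norm (V z) < 1" if "norm z < 1" for z
  proof -
    have z: "z \<in> unit_disc" using that by simp
    have lt: "norm (w z) < norm (2 - w z)"
      using norm_triangle_ineq2[of 2 "w z"] w[OF z] by simp
    then have "2 - w z \<noteq> 0" by auto
    then have "V z = w z / (2 - w z)"
      by (simp add: V_def Fw[OF z] field_simps)
    then have "norm (V z) = norm (w z) / norm (2 - w z)"
      by (simp only: norm_divide)
    also have "\<dots> < 1"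
      by (subst divide_less_eq_1_pos) (use lt in \<open>auto intro: le_less_trans[OF norm_ge_zero]\<close>)
    finally show ?thesis .
  qed
  obtain h where h: "h holomorphic_on unit_disc" "\<And>z. norm z < 1 \<Longrightarrow> V z = z * h z"
    "deriv V 0 = h 0"
    using Schwarz3[OF holV V0] by blast
  \<comment> \<open>At 0 the quotient is the derivative of \<open>V\<close>, hence the derivative
    part of the Schwarz lemma.\<close>
  have "norm (h z) \<le> 1" if "norm z < 1" for z
  proof (cases "z = 0")
    case True
    then show ?thesis
      using Schwarz_Lemma(2)[OF holV V0 V1, of 0] h(3) by simp
  next
    case False
    then show ?thesis
      using Schwarz_Lemma(1)[OF holV V0 V1 that] h(2)[OF that] by (simp add: norm_mult)
  qed
  moreover have "F z = 1 + z * (2 * h z)" if "norm z < 1" for z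
    using h(2)[OF that] by (simp add: V_def field_simps)
  ultimately show thesis
    using h(1) by (intro that[of "\<lambda>z. 2 * h z"]) (auto intro!: holomorphic_intros simp: norm_mult)
qed

text \<open>Writing f = z g with g(0) = 1, the function p = f'/g is the analytic version of z f'/f
  as long as g and f' do not vanish. Differentiating z f' = p f gives the formula with z
  p'/p.\<close>

lemma class_H_local_quotient:
  assumes "f \<in> class_H"
  obtains r p where "0 < r" "r \<le> 1" "p holomorphic_on ball 0 r" "p 0 = 1"
    and "\<And>z. z \<in> ball 0 r \<Longrightarrow> p z \<noteq> 0 \<and> z * deriv f z = p z * f z"
    and "\<And>z. z \<in> ball 0 r - {0} \<Longrightarrow> star_quot f z = p z \<and>
           1 - star_quot f z + convex_quot f z = z * deriv p z / p z"
proof -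
  have holf: "f holomorphic_on unit_disc" and f0: "f 0 = 0" and f1: "deriv f 0 = 1"
    using assms by (auto simp: class_H_def)
  obtain g where g: "g holomorphic_on unit_disc" "\<And>z. norm z < 1 \<Longrightarrow> f z = z * g z" "g 0 = 1"
    using Schwarz3[OF holf f0] f1 by metis
  have holf': "deriv f holomorphic_on unit_disc"
    by (intro holomorphic_deriv holf) auto
  \<comment> \<open>The product equals 1 at 0, so a single radius keeps both factors
    nonzero.\<close>
  have "continuous_on unit_disc (\<lambda>z. g z * deriv f z)"
    by (intro continuous_intros holomorphic_on_imp_continuous_on g holf')
  then have "isCont (\<lambda>z. g z * deriv f z) 0"
    by (simp add: continuous_on_eq_continuous_at)
  then obtain s where s: "s > 0" "\<And>z. dist 0 z < s \<Longrightarrow> g z * deriv f z \<noteq> 0"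
    using continuous_at_avoid[of 0 "\<lambda>z. g z * deriv f z" 0] g(3) f1 by auto
  define r where "r = min s 1"
  define p where "p z = deriv f z / g z" for z
  have r: "0 < r" "r \<le> 1" using s(1) by (auto simp: r_def)
  have nz: "g z \<noteq> 0" "deriv f z \<noteq> 0" if "z \<in> ball 0 r" for z
    using s(2)[of z] that by (auto simp: r_def)
  have sub: "ball 0 r \<subseteq> unit_disc" using r by auto
  have holp: "p holomorphic_on ball 0 r"
    unfolding p_def using nz by (intro holomorphic_intros holomorphic_on_subset[OF g(1) sub]
      holomorphic_on_subset[OF holf' sub]) auto
  show thesis
  proof (rule that[OF r holp])
    show "p 0 = 1" by (simp add: p_def g f1)
    show eq: "p z \<noteq> 0 \<and> z * deriv f z = p z * f z" if "z \<in> ball 0 r" for z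
      using nz[OF that] g(2)[of z] that r by (simp add: p_def)
    show "star_quot f z = p z \<and> 1 - star_quot f z + convex_quot f z = z * deriv p z / p z"
      if z: "z \<in> ball 0 r - {0}" for z
    proof -
      have zr: "z \<in> ball 0 r" and z1: "z \<in> unit_disc" and "z \<noteq> 0" using z sub by auto
      have fz: "f z \<noteq> 0" using g(2)[of z] nz[OF zr] z1 \<open>z \<noteq> 0\<close> by simp
      have star: "star_quot f z = p z"
        using eq[OF zr] fz by (simp add: star_quot_def)
      \<comment> \<open>The derivative of z f' is computed twice, directly and through p f, and the
        results are compared.\<close>
      have "((\<lambda>z. z * deriv f z) has_field_derivative deriv f z + z * deriv (deriv f) z) (at z)"
        by (rule derivative_eq_intros refl holomorphic_derivI[OF holf' open_ball z1])+ simp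
      moreover have "((\<lambda>z. p z * f z) has_field_derivative deriv p z * f z + p z * deriv f z) (at z)"
        by (rule derivative_eq_intros refl holomorphic_derivI[OF holf open_ball z1]
            holomorphic_derivI[OF holp open_ball zr])+ (simp add: algebra_simps)
      then have "((\<lambda>z. z * deriv f z) has_field_derivative deriv p z * f z + p z * deriv f z) (at z)"
        by (rule has_field_derivative_transform_within_open[OF _ open_ball zr]) (use eq in simp)
      ultimately have d: "deriv f z + z * deriv (deriv f) z = deriv p z * f z + p z * deriv f z"
        by (rule DERIV_unique)
      have "1 - p z + convex_quot f z = (deriv f z + z * deriv (deriv f) z - p z * deriv f z) / deriv f z"
        using nz[OF zr] by (simp add: convex_quot_def field_simps)
      also have "\<dots> = deriv p z * f z / deriv f z"
        by (simp add: d)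
      also have "\<dots> = z * deriv p z / p z"
        using eq[OF zr] nz[OF zr] by (simp add: field_simps)
      finally show ?thesis using star by simp
    qed
  qed
qed

section \<open>From a local identity to membership in the class\<close>

text \<open>The division-free identity determines z f'/f away from the zeros of f. These are
  isolated, so filling in limits yields exp L on the whole disc, and \<open>L\<close> serves as the
  subordinating function.\<close>

lemma class_S_star_eI:
  assumes "f \<in> class_H" and hol: "L holomorphic_on unit_disc" and "L 0 = 0"
    and L1: "\<And>z. z \<in> unit_disc \<Longrightarrow> norm (L z) < 1"
    and eq: "\<And>z. z \<in> unit_disc \<Longrightarrow> z * deriv f z = exp (L z) * f z"
  shows "f \<in> class_S_star_e"
proof -
  have holf: "f holomorphic_on unit_disc" and f1: "deriv f 0 = 1"
    using assms by (auto simp: class_H_def)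
  have "\<exists>\<beta>\<in>unit_disc. f \<beta> \<noteq> 0"
  proof (rule ccontr)
    assume "\<not> ?thesis"
    then have "(f has_field_derivative 0) (at 0)"
      by (intro has_field_derivative_transform_within_open[OF DERIV_const open_ball, of _ 0 1 0]) auto
    with f1 show False by (simp add: DERIV_imp_deriv)
  qed
  then obtain b where b: "b \<in> unit_disc" "f b \<noteq> 0" by blast
  have rs: "remove_sings (star_quot f) z = exp (L z)" if z: "z \<in> unit_disc" for z
  proof (rule remove_sings_eqI)
    have "\<forall>\<^sub>F w in at z. f w \<noteq> 0 \<and> w \<in> unit_disc"
      by (rule non_zero_neighbour_alt[OF holf open_ball connected_ball z b])
    then have "\<forall>\<^sub>F w in at z. exp (L w) = star_quot f w"
      by eventually_elim (simp add: star_quot_def eq)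
    moreover have "((\<lambda>w. exp (L w)) \<longlongrightarrow> exp (L z)) (at z)"
      using holomorphic_on_imp_continuous_on[OF hol] z
      by (intro tendsto_intros) (simp add: continuous_on_eq_continuous_at isContD)
    ultimately show "(star_quot f \<longlongrightarrow> exp (L z)) (at z)"
      by (rule Lim_transform_eventually[rotated])
  qed
  have "(\<lambda>z. exp (L z)) holomorphic_on unit_disc"
    by (intro holomorphic_intros hol)
  then have "remove_sings (star_quot f) holomorphic_on unit_disc"
    using holomorphic_transform rs by metis
  then show ?thesis
    using assms rs by (auto simp: class_S_star_e_def subordinate_def intro!: holomorphic_intros exI[of _ L])
qed

theorem mainTheorem5:
  fixes n :: nat and \<beta> :: real and f :: "complex \<Rightarrow> complex"
  assumes "\<beta> > 0" and "\<beta> \<ge> 2 * exp (real n)"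
    and "f \<in> class_H"
    and "subordinate
           (remove_sings (\<lambda>z. 1 + complex_of_real \<beta> * star_quot f z powi (- int n) *
                               (1 - star_quot f z + convex_quot f z)))
           (\<lambda>z. (2 + z) / (2 - z))"
  shows "f \<in> class_S_star_e"
proof -
  define E where "E = (\<lambda>z. 1 + complex_of_real \<beta> * star_quot f z powi (- int n) *
                               (1 - star_quot f z + convex_quot f z))"
  obtain H where H: "H holomorphic_on unit_disc"
    "\<And>z. z \<in> unit_disc \<Longrightarrow> remove_sings E z = 1 + z * H z"
    "\<And>z. z \<in> unit_disc \<Longrightarrow> norm (H z) \<le> 2"
    using subordinate_half_plane_kernel[OF assms(4)] unfolding E_def by blast
  obtain L where L: "L 0 = 0" "\<And>z. z \<in> unit_disc \<Longrightarrow> norm (L z) < 1"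
    "\<And>z. z \<in> unit_disc \<Longrightarrow> (L has_field_derivative H z / \<beta> * exp (of_nat n * L z)) (at z)"
  \<comment> \<open>The hypothesis on \<open>\<beta>\<close> enters here: |H| \<le> 2 and \<beta>
    \<ge> 2 e^n give |H/\<beta>| \<le> e^(-n).\<close>
  proof (rule exists_small_solution[of "\<lambda>z. H z / \<beta>" n])
    show "(\<lambda>z. H z / \<beta>) holomorphic_on unit_disc"
      using \<open>\<beta> > 0\<close> by (intro holomorphic_intros H) auto
    fix z :: complex assume "z \<in> unit_disc"
    then have "norm (H z / \<beta>) \<le> 2 / \<beta>"
      using H(3)[of z] \<open>\<beta> > 0\<close> by (simp add: norm_divide divide_right_mono)
    also have "\<dots> \<le> exp (- real n)"
      using assms(1,2) by (simp add: exp_minus field_simps)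
    finally show "norm (H z / \<beta>) \<le> exp (- real n)" .
  qed (rule that)
  have holL: "L holomorphic_on unit_disc"
    by (auto simp: holomorphic_on_open intro: L(3))
  have holf: "f holomorphic_on unit_disc"
    using assms(3) by (simp add: class_H_def)
  obtain r p where r: "0 < r" "r \<le> 1" and p: "p holomorphic_on ball 0 r" "p 0 = 1"
    "\<And>z. z \<in> ball 0 r \<Longrightarrow> p z \<noteq> 0 \<and> z * deriv f z = p z * f z"
    and quot: "\<And>z. z \<in> ball 0 r - {0} \<Longrightarrow> star_quot f z = p z \<and>
           1 - star_quot f z + convex_quot f z = z * deriv p z / p z"
    using class_H_local_quotient[OF assms(3)] by metis
  have sub: "ball 0 r \<subseteq> unit_disc" using r by auto
  have ode_p: "deriv p z / p z ^ Suc n = H z / \<beta>" if z: "z \<in> ball 0 r - {0}" for z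
  proof -
    \<comment> \<open>The origin is removed because \<open>star_quot f 0\<close> is the default 0
      instead of 1.\<close>
    have op: "open (ball 0 r - {0 :: complex})" by auto
    have E_eq: "E z = 1 + \<beta> * (z * deriv p z / p z ^ Suc n)" if "z \<in> ball 0 r - {0}" for z
    proof -
      have "E z = 1 + \<beta> * p z powi (- int n) * (z * deriv p z / p z)"
        using quot[OF that] unfolding E_def by metis
      then show ?thesis
        by (simp add: power_int_minus field_simps)
    qed
    have "deriv p holomorphic_on ball 0 r - {0}" "p holomorphic_on ball 0 r - {0}"
      by (intro holomorphic_deriv op holomorphic_on_subset[OF p(1)]; auto)+
    then have "(\<lambda>z. 1 + \<beta> * (z * deriv p z / p z ^ Suc n)) holomorphic_on ball 0 r - {0}"
      using p(3) by (intro holomorphic_intros) auto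
    then have "E holomorphic_on ball 0 r - {0}"
      by (rule holomorphic_transform) (simp only: E_eq)
    \<comment> \<open>At a point of analyticity \<open>remove_sings\<close> leaves the value of
      \<open>E\<close> unchanged.\<close>
    then have "E analytic_on {z}"
      using op z analytic_at by blast
    then have "E z = 1 + z * H z"
      using H(2)[of z] z sub by auto
    then have "z * H z = z * (\<beta> * (deriv p z / p z ^ Suc n))"
      using E_eq[OF z] by (simp add: mult_ac)
    then have "H z = \<beta> * (deriv p z / p z ^ Suc n)"
      using z by (subst (asm) mult_cancel_left) auto
    then show ?thesis
      using \<open>\<beta> > 0\<close> by simp
  qed
  have p_eq: "p z = exp (L z)" if "z \<in> ball 0 r" for z
  proof (rule power_ode_unique[of "ball 0 r" 0 p "\<lambda>z. exp (L z)" n z])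
    show "(\<lambda>z. exp (L z)) holomorphic_on ball 0 r"
      by (intro holomorphic_intros holomorphic_on_subset[OF holL sub])
    fix z :: complex assume z: "z \<in> ball 0 r - {0}"
    have "((\<lambda>z. exp (L z)) has_field_derivative exp (L z) * (H z / \<beta> * exp (of_nat n * L z))) (at z)"
      using DERIV_chain'[OF L(3) DERIV_exp, of z] z sub by auto
    \<comment> \<open>One factor exp L comes from the chain rule and n more from the equation for
      \<open>L\<close>, so exp L satisfies the same equation as \<open>p\<close>.\<close>
    then have "deriv (\<lambda>z. exp (L z)) z = H z / \<beta> * exp (L z) ^ Suc n"
      by (subst DERIV_imp_deriv) (simp_all add: exp_of_nat_mult mult.left_commute)
    then show "deriv p z / p z ^ Suc n = deriv (\<lambda>z. exp (L z)) z / exp (L z) ^ Suc n"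
      using ode_p[OF z] by simp
  qed (use p r L(1) that in auto)
  show ?thesis
  proof (rule class_S_star_eI[OF assms(3) holL L(1,2)])
    fix z :: complex assume "z \<in> unit_disc"
    then show "z * deriv f z = exp (L z) * f z"
    \<comment> \<open>Both sides are holomorphic on the whole disc and agree on
      \<open>ball 0 r\<close>, where \<open>p\<close> equals exp L.\<close>
    proof (rule analytic_continuation_open[OF open_ball open_ball _ connected_ball sub, rotated -1])
      show "(\<lambda>z. z * deriv f z) holomorphic_on unit_disc"
        by (intro holomorphic_intros holomorphic_deriv holf open_ball)
      show "(\<lambda>z. exp (L z) * f z) holomorphic_on unit_disc"
        by (intro holomorphic_intros holf holL)
    qed (use r p(3) p_eq in auto)
  qed auto
qed

end
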